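(* Let $\kappa$ be an infinite cardinal and let $\{X_s:s\in S\}$ be any family of spaces with $X_s\in\mathcal C_\kappa$ for each $s\in S$. Then the Cartesian product $\prod\{X_s:s\in S\}$ belongs to $\mathcal C_\kappa$.
   Context: A continuous surjection $f:X\to Y$ is skeletal if for every non-empty open $U\subseteq X$ the closure of $f[U]$ has non-empty interior. A directed set $\Sigma$ is $\kappa$-complete if every chain of length $\le\kappa$ consisting of elements of $\Sigma$ has a least upper bound in $\Sigma$. An inverse system $\{X_\sigma,\pi^\sigma_\varrho,\Sigma\}$ is $\kappa$-complete if $\Sigma$ is $\kappa$-complete and for every chain $A\subseteq\Sigma$ with $|A|\le\kappa$ and $\sigma=\sup A\in\Sigma$ we have $X_\sigma=\varprojlim\{X_\alpha,\pi^\beta_\alpha,A\}$. All bonding maps are assumed to be (continuous) surjections. For an infinite cardinal $\kappa$, $\mathcal C_\kappa$ is the class of all spaces that are (homeomorphic to) inverse limits of $\kappa$-complete inverse systems $\{X_\sigma,\pi^\sigma_\varrho,\Sigma\}$ in which every $X_\sigma$ is a $T_0$-space of weight $\operatorname{w}(X_\sigma)\le\kappa$ and all bonding maps $\pi^\sigma_\varrho$ are skeletal. *)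

theory Defs
  imports "HOL-Analysis.Analysis"
begin

unbundle cardinal_syntax

text \<open>
  Cardinals are represented, as in the library, by cardinal orders \<open>\<kappa> :: 'k rel\<close>;
  an infinite cardinal is one with \<open>Cinfinite \<kappa>\<close>.
\<close>

definition base_of :: "'a topology \<Rightarrow> 'a set set \<Rightarrow> bool" where
  "base_of X \<B> \<longleftrightarrow>
     (\<forall>V\<in>\<B>. openin X V) \<and>
     (\<forall>U x. openin X U \<and> x \<in> U \<longrightarrow> (\<exists>V\<in>\<B>. x \<in> V \<and> V \<subseteq> U))"

definition weight :: "'a topology \<Rightarrow> 'a set rel" where
  "weight X = |SOME \<B>. base_of X \<B> \<and> (\<forall>\<B>'. base_of X \<B>' \<longrightarrow> |\<B>| \<le>o |\<B>'| )|"

lemma weight_attained: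
  obtains \<B> where "base_of X \<B>" "weight X = |\<B>|" "\<And>\<B>'. base_of X \<B>' \<Longrightarrow> |\<B>| \<le>o |\<B>'|"
proof -
  have "base_of X {U. openin X U}"
    unfolding base_of_def by blast
  then have "{U. openin X U} \<in> Collect (base_of X)"
    by simp
  then obtain \<B> where \<B>: "\<B> \<in> Collect (base_of X)"
    and min: "\<And>\<B>'. (\<B>', \<B>) \<in> inv_image ordLess card_of \<Longrightarrow> \<B>' \<notin> Collect (base_of X)"
    using wfE_min[OF wf_inv_image[OF wf_ordLess]] by metis
  have "\<exists>\<B>. base_of X \<B> \<and> (\<forall>\<B>'. base_of X \<B>' \<longrightarrow> |\<B>| \<le>o |\<B>'| )"
    using \<B> min by (intro exI[of _ \<B>])
      (auto simp: inv_image_def simp flip: not_ordLess_iff_ordLeq[OF card_of_Well_order card_of_Well_order])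
  from someI_ex[OF this] that show thesis
    unfolding weight_def by blast
qed

lemma weight_le_iff: "weight X \<le>o \<kappa> \<longleftrightarrow> (\<exists>\<B>. base_of X \<B> \<and> |\<B>| \<le>o \<kappa>)"
  by (metis weight_attained ordLeq_transitive)

definition skeletal_map :: "'a topology \<Rightarrow> 'b topology \<Rightarrow> ('a \<Rightarrow> 'b) \<Rightarrow> bool" where
  "skeletal_map X Y f \<longleftrightarrow>
     continuous_map X Y f \<and> f ` topspace X = topspace Y \<and>
     (\<forall>U. openin X U \<and> U \<noteq> {} \<longrightarrow> Y interior_of (Y closure_of (f ` U)) \<noteq> {})"

text \<open>A pair \<open>(\<rho>, \<sigma>) \<in> r\<close> is read as \<open>\<rho> \<le> \<sigma>\<close>.\<close>

definition directed_set :: "'i set \<Rightarrow> 'i rel \<Rightarrow> bool" where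
  "directed_set \<Sigma> r \<longleftrightarrow>
     partial_order_on \<Sigma> r \<and> \<Sigma> \<noteq> {} \<and>
     (\<forall>\<rho>\<in>\<Sigma>. \<forall>\<sigma>\<in>\<Sigma>. \<exists>\<tau>\<in>\<Sigma>. (\<rho>, \<tau>) \<in> r \<and> (\<sigma>, \<tau>) \<in> r)"

definition least_upper_bound :: "'i set \<Rightarrow> 'i rel \<Rightarrow> 'i set \<Rightarrow> 'i \<Rightarrow> bool" where
  "least_upper_bound \<Sigma> r A \<sigma> \<longleftrightarrow>
     \<sigma> \<in> \<Sigma> \<and> (\<forall>\<alpha>\<in>A. (\<alpha>, \<sigma>) \<in> r) \<and>
     (\<forall>\<tau>\<in>\<Sigma>. (\<forall>\<alpha>\<in>A. (\<alpha>, \<tau>) \<in> r) \<longrightarrow> (\<sigma>, \<tau>) \<in> r)"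

text \<open>
  Chains are taken to be non-empty: otherwise \<open>\<Sigma>\<close> would have to have a least element,
  and the corresponding space, the limit of the empty system, would be a singleton.
\<close>

definition short_chain :: "'k rel \<Rightarrow> 'i set \<Rightarrow> 'i rel \<Rightarrow> 'i set \<Rightarrow> bool" where
  "short_chain \<kappa> \<Sigma> r A \<longleftrightarrow> A \<subseteq> \<Sigma> \<and> A \<in> Chains r \<and> A \<noteq> {} \<and> |A| \<le>o \<kappa>"

definition complete_directed_set :: "'k rel \<Rightarrow> 'i set \<Rightarrow> 'i rel \<Rightarrow> bool" where
  "complete_directed_set \<kappa> \<Sigma> r \<longleftrightarrow>
     directed_set \<Sigma> r \<and>
     (\<forall>A. short_chain \<kappa> \<Sigma> r A \<longrightarrow> (\<exists>\<sigma>. least_upper_bound \<Sigma> r A \<sigma>))"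

text \<open>The bonding map from \<open>X \<sigma>\<close> onto \<open>X \<rho>\<close>, for \<open>\<rho> \<le> \<sigma>\<close>, is \<open>p \<sigma> \<rho>\<close>.\<close>

definition inverse_system ::
  "'i set \<Rightarrow> 'i rel \<Rightarrow> ('i \<Rightarrow> 'p topology) \<Rightarrow> ('i \<Rightarrow> 'i \<Rightarrow> 'p \<Rightarrow> 'p) \<Rightarrow> bool" where
  "inverse_system \<Sigma> r X p \<longleftrightarrow>
     directed_set \<Sigma> r \<and>
     (\<forall>\<rho> \<sigma>. (\<rho>, \<sigma>) \<in> r \<longrightarrow>
        continuous_map (X \<sigma>) (X \<rho>) (p \<sigma> \<rho>) \<and> p \<sigma> \<rho> ` topspace (X \<sigma>) = topspace (X \<rho>)) \<and>
     (\<forall>\<sigma>\<in>\<Sigma>. \<forall>x\<in>topspace (X \<sigma>). p \<sigma> \<sigma> x = x) \<and>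
     (\<forall>\<rho> \<sigma> \<tau>. (\<rho>, \<sigma>) \<in> r \<and> (\<sigma>, \<tau>) \<in> r \<longrightarrow>
        (\<forall>x\<in>topspace (X \<tau>). p \<sigma> \<rho> (p \<tau> \<sigma> x) = p \<tau> \<rho> x))"

definition inverse_limit ::
  "'i set \<Rightarrow> 'i rel \<Rightarrow> ('i \<Rightarrow> 'p topology) \<Rightarrow> ('i \<Rightarrow> 'i \<Rightarrow> 'p \<Rightarrow> 'p) \<Rightarrow> ('i \<Rightarrow> 'p) topology" where
  "inverse_limit A r X p =
     subtopology (product_topology X A)
       {x. \<forall>\<rho>\<in>A. \<forall>\<sigma>\<in>A. (\<rho>, \<sigma>) \<in> r \<longrightarrow> p \<sigma> \<rho> (x \<sigma>) = x \<rho>}"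

text \<open>
  The requirement that \<open>X \<sigma>\<close> is the limit of the system restricted to \<open>A\<close> means, as usual,
  that the canonical map induced by the bonding maps \<open>p \<sigma> \<alpha>\<close>, \<open>\<alpha> \<in> A\<close>, is a homeomorphism.
\<close>

definition complete_inverse_system ::
  "'k rel \<Rightarrow> 'i set \<Rightarrow> 'i rel \<Rightarrow> ('i \<Rightarrow> 'p topology) \<Rightarrow> ('i \<Rightarrow> 'i \<Rightarrow> 'p \<Rightarrow> 'p) \<Rightarrow> bool" where
  "complete_inverse_system \<kappa> \<Sigma> r X p \<longleftrightarrow>
     inverse_system \<Sigma> r X p \<and> complete_directed_set \<kappa> \<Sigma> r \<and>
     (\<forall>A \<sigma>. short_chain \<kappa> \<Sigma> r A \<and> least_upper_bound \<Sigma> r A \<sigma> \<longrightarrow>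
        homeomorphic_map (X \<sigma>) (inverse_limit A r X p) (\<lambda>x. restrict (\<lambda>\<alpha>. p \<sigma> \<alpha> x) A))"

text \<open>
  Higher-order logic has no existential quantifier over types, so the types \<open>'i\<close> of the indices
  and \<open>'p\<close> of the points of the inverse systems that witness membership are parameters of the
  class. They only bound the cardinality of these systems: the index set and the spaces
  may be arbitrary subsets of \<open>'i\<close> and \<open>'p\<close>, so that a system can be copied along injections
  into any larger types. Membership in the unrestricted class is membership for some choice of
  \<open>'i\<close> and \<open>'p\<close>.
\<close>

definition skeletal_limits :: "'k rel \<Rightarrow> 'i itself \<Rightarrow> 'p itself \<Rightarrow> 'x topology set" where
  "skeletal_limits \<kappa> index_type point_type =
     {L. \<exists>(\<Sigma> :: 'i set) r (X :: 'i \<Rightarrow> 'p topology) p.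
           complete_inverse_system \<kappa> \<Sigma> r X p \<and>
           (\<forall>\<sigma>\<in>\<Sigma>. t0_space (X \<sigma>) \<and> weight (X \<sigma>) \<le>o \<kappa>) \<and>
           (\<forall>\<rho> \<sigma>. (\<rho>, \<sigma>) \<in> r \<longrightarrow> skeletal_map (X \<sigma>) (X \<rho>) (p \<sigma> \<rho>)) \<and>
           L homeomorphic_space inverse_limit \<Sigma> r X p}"

end

theory Submission
  imports Defs
begin

text \<open>
  Given systems for the factors, index the product by the partial functions \<open>g\<close> on \<open>S\<close> with at most
  \<open>\<kappa>\<close> values \<open>g s \<in> \<Sigma> s\<close>, and attach to \<open>g\<close> the product of the spaces \<open>X s (g s)\<close> over the domain
  of \<open>g\<close>. As \<open>\<kappa> \<cdot> \<kappa> = \<kappa>\<close>, these products have weight at most \<open>\<kappa>\<close>, and a chain of length at most \<open>\<kappa>\<close>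
  has a supremum, which is formed coordinatewise on the union of the domains. The bonding maps are
  projections followed by products of skeletal maps; they are skeletal because a basic open box
  restricts only finitely many coordinates. For every directed set \<open>B\<close> of indices, the limit over \<open>B\<close>
  is the product over \<open>s\<close> of the limits over the \<open>s\<close>-coordinates of \<open>B\<close>. For \<open>B\<close> a chain this
  gives \<open>\<kappa>\<close>-completeness, and for \<open>B\<close> the whole index set it identifies the limit with the product.
\<close>

section \<open>Bases and weight of products\<close>

text \<open>Each box is coded by a finite set of pairs \<open>(i, V)\<close>, so that boxes are
  counted by counting finite subsets of \<open>Sigma I \<B>\<close>. Several pairs may share an
  index; their conditions then intersect, and openness follows by adding one pair at a time.\<close>

lemma base_of_product_topology:
  assumes "\<And>i. i \<in> I \<Longrightarrow> base_of (X i) (\<B> i)"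
  shows "base_of (product_topology X I)
    ((\<lambda>T. {x \<in> topspace (product_topology X I). \<forall>(i, V)\<in>T. x i \<in> V}) ` Fpow (Sigma I \<B>))"
    (is "base_of ?P (?box ` _)")
  unfolding base_of_def
proof (intro conjI ballI allI impI)
  fix W assume "W \<in> ?box ` Fpow (Sigma I \<B>)"
  then obtain T where T: "finite T" "T \<subseteq> Sigma I \<B>" and W: "W = ?box T"
    by (auto simp: Fpow_def)
  have "openin ?P (?box T)"
    using T
  proof (induction T rule: finite_induct)
    case empty
    show ?case by (simp flip: topspace_product_topology)
  next
    case (insert t T)
    obtain i V where t: "t = (i, V)" by (cases t)
    have "openin ?P {x \<in> topspace ?P. x i \<in> V}"
      using insert.prems assms t
      by (intro openin_continuous_map_preimage[of _ "X i"]) (auto simp: base_of_def)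
    moreover have "?box (insert t T) = {x \<in> topspace ?P. x i \<in> V} \<inter> ?box T"
      using t by auto
    ultimately show ?case
      using insert by (simp add: openin_Int)
  qed
  with W show "openin ?P W" by simp
next
  fix U x assume "openin ?P U \<and> x \<in> U"
  then obtain W where W: "finite {i \<in> I. W i \<noteq> topspace (X i)}" "\<And>i. i \<in> I \<Longrightarrow> openin (X i) (W i)"
      "x \<in> PiE I W" "PiE I W \<subseteq> U"
    unfolding openin_product_topology_alt by meson
  \<comment> \<open>\<open>F\<close> collects the finitely many coordinates that \<open>W\<close>
    really restricts; only there must a member of the base be chosen inside
    \<open>W i\<close>.\<close>
  define F where "F = {i \<in> I. W i \<noteq> topspace (X i)}"
  have "\<exists>V\<in>\<B> i. x i \<in> V \<and> V \<subseteq> W i" if "i \<in> F" for i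
    using that W assms[of i] unfolding F_def base_of_def by (auto simp: PiE_iff)
  then obtain V where V: "\<And>i. i \<in> F \<Longrightarrow> V i \<in> \<B> i \<and> x i \<in> V i \<and> V i \<subseteq> W i"
    by metis
  define T where "T = (\<lambda>i. (i, V i)) ` F"
  have T: "T \<in> Fpow (Sigma I \<B>)"
    using V W(1) unfolding T_def Fpow_def F_def by auto
  have "x \<in> topspace ?P"
    using W(2,3) openin_subset[OF W(2)] by (fastforce simp: PiE_iff)
  then have x: "x \<in> ?box T"
    using V unfolding T_def by simp
  have "?box T \<subseteq> U"
  proof -
    have "y i \<in> W i" if "y \<in> ?box T" "i \<in> I" for y i
    proof (cases "i \<in> F")
      case True
      with that have "y i \<in> V i" by (auto simp: T_def)
      with V[OF True] show ?thesis by blast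
    next
      case False
      with that show ?thesis by (auto simp: F_def PiE_iff)
    qed
    then have "?box T \<subseteq> PiE I W" by (auto simp: PiE_iff extensional_def)
    with W(4) show ?thesis by (rule subset_trans[rotated])
  qed
  with x show "\<exists>B\<in>?box ` Fpow (Sigma I \<B>). x \<in> B \<and> B \<subseteq> U"
    by (intro bexI[of _ "?box T"] conjI imageI T)
qed

text \<open>The finite subsets split into countably many layers by cardinality. Inserting an element
  maps \<open>A \<times> F n\<close> onto a superset of the next layer, so each layer is bounded by
  \<kappa> because the product of \<kappa> with itself is \<kappa>, and so is the countable
  union.\<close>

lemma card_of_Fpow_ordLeq:
  assumes "Cinfinite \<kappa>" "|A| \<le>o \<kappa>"
  shows "|Fpow A| \<le>o \<kappa>"
proof -
  define F where "F n = {T. T \<subseteq> A \<and> finite T \<and> card T = n}" for n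
  have "|F n| \<le>o \<kappa>" for n
  proof (induction n)
    case 0
    have "F 0 = {{}}" by (auto simp: F_def)
    moreover have "Field \<kappa> \<noteq> {}"
      using assms(1) by (auto simp: cinfinite_def)
    ultimately show ?case
      using assms(1) by (simp add: Card_order_singl_ordLeq)
  next
    case (Suc n)
    have "F (Suc n) \<subseteq> (\<lambda>(a, T). insert a T) ` (A \<times> F n)"
      by (fastforce simp: F_def card_Suc_eq)
    moreover have "|A \<times> F n| \<le>o \<kappa>"
      using assms Suc by (intro card_of_Sigma_ordLeq_infinite_Field) (auto simp: cinfinite_def)
    ultimately show ?case
      by (meson card_of_image card_of_mono1 ordLeq_transitive)
  qed
  moreover have "|UNIV :: nat set| \<le>o \<kappa>"
    using assms(1) card_of_nat natLeq_ordLeq_cinfinite ordIso_ordLeq_trans by blast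
  ultimately have "|\<Union>n. F n| \<le>o \<kappa>"
    using assms(1) by (intro UNION_Cinfinite_bound) auto
  moreover have "Fpow A = (\<Union>n. F n)"
    by (auto simp: F_def Fpow_def)
  ultimately show ?thesis by simp
qed

lemma weight_product_topology:
  assumes "Cinfinite \<kappa>" "|I| \<le>o \<kappa>" "\<And>i. i \<in> I \<Longrightarrow> weight (X i) \<le>o \<kappa>"
  shows "weight (product_topology X I) \<le>o \<kappa>"
proof -
  obtain \<B> where \<B>: "\<And>i. i \<in> I \<Longrightarrow> base_of (X i) (\<B> i)" "\<And>i. i \<in> I \<Longrightarrow> |\<B> i| \<le>o \<kappa>"
    using assms(3) unfolding weight_le_iff by metis
  have "|Sigma I \<B>| \<le>o \<kappa>"
    using assms \<B> by (intro card_of_Sigma_ordLeq_infinite_Field) (auto simp: cinfinite_def)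
  then have "|Fpow (Sigma I \<B>)| \<le>o \<kappa>"
    by (rule card_of_Fpow_ordLeq[OF assms(1)])
  from ordLeq_transitive[OF card_of_image this] base_of_product_topology[OF \<B>(1)] show ?thesis
    unfolding weight_le_iff by (intro exI conjI)
qed

section \<open>Skeletal maps and homeomorphisms between products\<close>

text \<open>The map forgets the coordinates outside \<open>J\<close> and applies \<open>f j\<close>
  to the others. It sends a nonempty box to a box, and the closure of that box contains the product
  of the interiors of the closures of its sides. The hypothesis \<open>ne\<close> makes forgetting
  coordinates surjective.\<close>

lemma skeletal_map_product_topology:
  assumes "J \<subseteq> I" and skel: "\<And>j. j \<in> J \<Longrightarrow> skeletal_map (X j) (Y j) (f j)"
    and ne: "\<And>i. i \<in> I \<Longrightarrow> topspace (X i) \<noteq> {}"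
  shows "skeletal_map (product_topology X I) (product_topology Y J) (\<lambda>x. \<lambda>j\<in>J. f j (x j))"
    (is "skeletal_map ?X ?Y ?f")
proof -
  have image: "?f ` PiE I U = (\<Pi>\<^sub>E j\<in>J. f j ` U j)" if U: "PiE I U \<noteq> {}" for U
  proof (intro equalityI subsetI)
    fix y assume "y \<in> ?f ` PiE I U"
    with assms(1) show "y \<in> (\<Pi>\<^sub>E j\<in>J. f j ` U j)" by (force simp: PiE_iff)
  next
    fix y assume y: "y \<in> (\<Pi>\<^sub>E j\<in>J. f j ` U j)"
    then have "\<forall>j\<in>J. \<exists>u\<in>U j. y j = f j u" by (auto simp: PiE_iff)
    then obtain u where u: "\<And>j. j \<in> J \<Longrightarrow> u j \<in> U j \<and> y j = f j (u j)" by metis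
    \<comment> \<open>A preimage of \<open>y\<close> has prescribed values only on \<open>J\<close>;
      the point \<open>z\<close> fills in the remaining coordinates.\<close>
    obtain z where z: "z \<in> PiE I U" using U by blast
    define x where "x = (\<lambda>i\<in>I. if i \<in> J then u i else z i)"
    have "x \<in> PiE I U" using u z by (auto simp: x_def PiE_iff)
    moreover have "?f x = y"
      using u y assms(1) by (auto simp: x_def PiE_iff extensional_def fun_eq_iff)
    ultimately show "y \<in> ?f ` PiE I U" by blast
  qed
  have "continuous_map ?X ?Y ?f"
    unfolding continuous_map_componentwise
  proof (intro conjI ballI)
    fix j assume j: "j \<in> J"
    have "continuous_map ?X (Y j) (f j \<circ> (\<lambda>x. x j))"
      using j assms(1) skel[OF j]
      by (intro continuous_map_compose[of _ "X j"]) (auto simp: skeletal_map_def)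
    with j show "continuous_map ?X (Y j) (\<lambda>x. ?f x j)"
      by (simp add: o_def)
  qed auto
  moreover have "?f ` topspace ?X = topspace ?Y"
  proof -
    have "PiE I (\<lambda>i. topspace (X i)) \<noteq> {}"
      using ne by (simp add: PiE_eq_empty_iff)
    from image[OF this] have "?f ` topspace ?X = (\<Pi>\<^sub>E j\<in>J. f j ` topspace (X j))"
      by simp
    also have "\<dots> = (\<Pi>\<^sub>E j\<in>J. topspace (Y j))"
      using skel by (intro PiE_cong) (simp add: skeletal_map_def)
    finally show ?thesis by simp
  qed
  moreover have "?Y interior_of (?Y closure_of (?f ` U)) \<noteq> {}" if U: "openin ?X U" "U \<noteq> {}" for U
  proof -
    obtain x where "x \<in> U" using U by blast
    with U obtain W where W: "finite {i \<in> I. W i \<noteq> topspace (X i)}"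
        "\<And>i. i \<in> I \<Longrightarrow> openin (X i) (W i)" "x \<in> PiE I W" "PiE I W \<subseteq> U"
      unfolding openin_product_topology_alt by meson
    define V where "V j = Y j interior_of (Y j closure_of (f j ` W j))" for j
    have "V j \<noteq> {}" if "j \<in> J" for j
      using skel[OF that] W(2,3) assms(1) that unfolding V_def skeletal_map_def PiE_iff by blast
    then have "PiE J V \<noteq> {}" by (simp add: PiE_eq_empty_iff)
    moreover have "openin ?Y (PiE J V)"
    proof -
      \<comment> \<open>Surjectivity of \<open>f j\<close> makes \<open>V j\<close> the whole space
        wherever \<open>W j\<close> is. Hence \<open>V\<close> restricts only finitely many
        coordinates and its box is open.\<close>
      have "V j = topspace (Y j)" if "j \<in> J" "W j = topspace (X j)" for j
        using skel[OF that(1)] that(2) by (simp add: V_def skeletal_map_def)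
      then have "{j \<in> J. V j \<noteq> topspace (Y j)} \<subseteq> {i \<in> I. W i \<noteq> topspace (X i)}"
        using assms(1) by blast
      with W(1) show ?thesis
        unfolding openin_PiE_gen by (auto simp: V_def intro: finite_subset)
    qed
    moreover have "PiE J V \<subseteq> ?Y closure_of (?f ` U)"
    proof -
      have "PiE J V \<subseteq> (\<Pi>\<^sub>E j\<in>J. Y j closure_of (f j ` W j))"
        unfolding V_def by (intro PiE_mono) (auto simp: interior_of_subset)
      also have "\<dots> = ?Y closure_of (?f ` PiE I W)"
        by (subst image) (use W(3) in \<open>auto simp: closure_of_product_topology\<close>)
      also have "\<dots> \<subseteq> ?Y closure_of (?f ` U)"
        using W(4) by (intro closure_of_mono) blast
      finally show ?thesis .
    qed
    ultimately show ?thesis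
      using interior_of_maximal by blast
  qed
  ultimately show ?thesis
    unfolding skeletal_map_def by blast
qed

text \<open>The maps are kept explicit because \<kappa>-completeness demands that one particular
  map, the canonical one, be a homeomorphism.\<close>

lemma homeomorphic_maps_product_topology:
  assumes "\<And>i. i \<in> I \<Longrightarrow> homeomorphic_maps (X i) (Y i) (f i) (g i)"
  shows "homeomorphic_maps (product_topology X I) (product_topology Y I)
    (\<lambda>x. \<lambda>i\<in>I. f i (x i)) (\<lambda>y. \<lambda>i\<in>I. g i (y i))"
proof -
  have cont: "continuous_map (product_topology X I) (product_topology Y I) (\<lambda>x. \<lambda>i\<in>I. f i (x i))"
    if "\<And>i. i \<in> I \<Longrightarrow> continuous_map (X i) (Y i) (f i)" for X Y and f :: "'a \<Rightarrow> 'e \<Rightarrow> 'f"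
    unfolding continuous_map_componentwise
  proof (intro conjI ballI)
    fix i assume i: "i \<in> I"
    have "continuous_map (product_topology X I) (Y i) (f i \<circ> (\<lambda>x. x i))"
      using i that by (intro continuous_map_compose[of _ "X i"]) auto
    with i show "continuous_map (product_topology X I) (Y i) (\<lambda>x. (\<lambda>i\<in>I. f i (x i)) i)"
      by (simp add: o_def)
  qed auto
  show ?thesis
    unfolding homeomorphic_maps_def
  proof (intro conjI ballI)
    show "(\<lambda>i\<in>I. g i ((\<lambda>i\<in>I. f i (x i)) i)) = x" if "x \<in> topspace (product_topology X I)" for x
      using that assms by (auto simp: homeomorphic_maps_def PiE_iff extensional_def)
    show "(\<lambda>i\<in>I. f i ((\<lambda>i\<in>I. g i (y i)) i)) = y" if "y \<in> topspace (product_topology Y I)" for y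
      using that assms by (auto simp: homeomorphic_maps_def PiE_iff extensional_def)
  qed (use assms in \<open>auto simp: homeomorphic_maps_def intro!: cont\<close>)
qed

lemma homeomorphic_space_product_topology:
  assumes "\<And>i. i \<in> I \<Longrightarrow> X i homeomorphic_space Y i"
  shows "product_topology X I homeomorphic_space product_topology Y I"
proof -
  obtain f g where "\<And>i. i \<in> I \<Longrightarrow> homeomorphic_maps (X i) (Y i) (f i) (g i)"
    using assms unfolding homeomorphic_space_def by metis
  from homeomorphic_maps_product_topology[OF this] show ?thesis
    unfolding homeomorphic_space_def by (intro exI)
qed

section \<open>Threads of inverse limits\<close>

lemma topspace_inverse_limit:
  "x \<in> topspace (inverse_limit A r X p) \<longleftrightarrow>
     x \<in> (\<Pi>\<^sub>E \<alpha>\<in>A. topspace (X \<alpha>)) \<and> (\<forall>\<alpha>\<in>A. \<forall>\<beta>\<in>A. (\<alpha>, \<beta>) \<in> r \<longrightarrow> p \<beta> \<alpha> (x \<beta>) = x \<alpha>)"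
  by (simp add: inverse_limit_def)

lemma continuous_map_inverse_limit_projection:
  assumes "\<alpha> \<in> A"
  shows "continuous_map (inverse_limit A r X p) (X \<alpha>) (\<lambda>x. x \<alpha>)"
  using assms unfolding inverse_limit_def
  by (intro continuous_map_from_subtopology continuous_map_product_projection)

lemma continuous_map_into_inverse_limit:
  assumes "\<And>z. z \<in> topspace Z \<Longrightarrow> f z \<in> topspace (inverse_limit A r X p)"
    and "\<And>\<alpha>. \<alpha> \<in> A \<Longrightarrow> continuous_map Z (X \<alpha>) (\<lambda>z. f z \<alpha>)"
  shows "continuous_map Z (inverse_limit A r X p) f"
  using assms unfolding topspace_inverse_limit
  unfolding inverse_limit_def continuous_map_in_subtopology continuous_map_componentwise
  by (fastforce simp: PiE_iff)

section \<open>The system of small subproducts\<close>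

text \<open>One witnessing system is fixed for each factor. The assumption \<open>nonempty\<close>
  does not come from membership in the class: it makes the bonding maps that drop coordinates
  surjective, and empty spaces are treated separately.\<close>

locale skeletal_systems =
  fixes \<kappa> :: "'k rel" and S :: "'s set" and \<Sigma> :: "'s \<Rightarrow> 'i set" and r :: "'s \<Rightarrow> 'i rel"
    and X :: "'s \<Rightarrow> 'i \<Rightarrow> 'p topology" and p :: "'s \<Rightarrow> 'i \<Rightarrow> 'i \<Rightarrow> 'p \<Rightarrow> 'p"
  assumes \<kappa>: "Cinfinite \<kappa>"
    and system: "s \<in> S \<Longrightarrow> complete_inverse_system \<kappa> (\<Sigma> s) (r s) (X s) (p s)"
    and t0: "s \<in> S \<Longrightarrow> a \<in> \<Sigma> s \<Longrightarrow> t0_space (X s a)"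
    and weight_le: "s \<in> S \<Longrightarrow> a \<in> \<Sigma> s \<Longrightarrow> weight (X s a) \<le>o \<kappa>"
    and skeletal: "s \<in> S \<Longrightarrow> (a, b) \<in> r s \<Longrightarrow> skeletal_map (X s b) (X s a) (p s b a)"
    and nonempty: "s \<in> S \<Longrightarrow> a \<in> \<Sigma> s \<Longrightarrow> topspace (X s a) \<noteq> {}"
begin

lemma
  assumes "s \<in> S"
  shows directed_set_index: "directed_set (\<Sigma> s) (r s)"
    and bonding_id: "a \<in> \<Sigma> s \<Longrightarrow> x \<in> topspace (X s a) \<Longrightarrow> p s a a x = x"
    and bonding_comp: "(a, b) \<in> r s \<Longrightarrow> (b, c) \<in> r s \<Longrightarrow> x \<in> topspace (X s c) \<Longrightarrow>
      p s b a (p s c b x) = p s c a x"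
    and chain_has_lub: "short_chain \<kappa> (\<Sigma> s) (r s) A \<Longrightarrow>
      \<exists>\<sigma>. least_upper_bound (\<Sigma> s) (r s) A \<sigma>"
    and chain_limit: "short_chain \<kappa> (\<Sigma> s) (r s) A \<Longrightarrow> least_upper_bound (\<Sigma> s) (r s) A \<sigma> \<Longrightarrow>
      homeomorphic_map (X s \<sigma>) (inverse_limit A (r s) (X s) (p s)) (\<lambda>x. \<lambda>\<alpha>\<in>A. p s \<sigma> \<alpha> x)"
proof -
  note sys = system[OF assms, unfolded complete_inverse_system_def]
  note inv = sys[THEN conjunct1, unfolded inverse_system_def]
  show "directed_set (\<Sigma> s) (r s)" by (rule inv[THEN conjunct1])
  show "a \<in> \<Sigma> s \<Longrightarrow> x \<in> topspace (X s a) \<Longrightarrow> p s a a x = x"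
    using inv[THEN conjunct2, THEN conjunct2, THEN conjunct1] by blast
  show "(a, b) \<in> r s \<Longrightarrow> (b, c) \<in> r s \<Longrightarrow> x \<in> topspace (X s c) \<Longrightarrow> p s b a (p s c b x) = p s c a x"
    using inv[THEN conjunct2, THEN conjunct2, THEN conjunct2] by blast
  show "short_chain \<kappa> (\<Sigma> s) (r s) A \<Longrightarrow> \<exists>\<sigma>. least_upper_bound (\<Sigma> s) (r s) A \<sigma>"
    using sys[THEN conjunct2, THEN conjunct1, unfolded complete_directed_set_def] by blast
  show "short_chain \<kappa> (\<Sigma> s) (r s) A \<Longrightarrow> least_upper_bound (\<Sigma> s) (r s) A \<sigma> \<Longrightarrow>
      homeomorphic_map (X s \<sigma>) (inverse_limit A (r s) (X s) (p s)) (\<lambda>x. \<lambda>\<alpha>\<in>A. p s \<sigma> \<alpha> x)"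
    using sys[THEN conjunct2, THEN conjunct2] by blast
qed

lemma
  assumes "s \<in> S"
  shows index_refl: "a \<in> \<Sigma> s \<Longrightarrow> (a, a) \<in> r s"
    and index_trans: "(a, b) \<in> r s \<Longrightarrow> (b, c) \<in> r s \<Longrightarrow> (a, c) \<in> r s"
    and index_antisym: "(a, b) \<in> r s \<Longrightarrow> (b, a) \<in> r s \<Longrightarrow> a = b"
    and index_nonempty: "\<Sigma> s \<noteq> {}"
    and directed: "a \<in> \<Sigma> s \<Longrightarrow> b \<in> \<Sigma> s \<Longrightarrow> \<exists>c\<in>\<Sigma> s. (a, c) \<in> r s \<and> (b, c) \<in> r s"
proof -
  from directed_set_index[OF assms]
  have *: "refl_on (\<Sigma> s) (r s)" "trans (r s)" "antisym (r s)" "\<Sigma> s \<noteq> {}"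
    "\<forall>a\<in>\<Sigma> s. \<forall>b\<in>\<Sigma> s. \<exists>c\<in>\<Sigma> s. (a, c) \<in> r s \<and> (b, c) \<in> r s"
    by (auto simp: directed_set_def partial_order_on_def preorder_on_def)
  show "a \<in> \<Sigma> s \<Longrightarrow> (a, a) \<in> r s" by (rule refl_onD[OF *(1)])
  show "(a, b) \<in> r s \<Longrightarrow> (b, c) \<in> r s \<Longrightarrow> (a, c) \<in> r s" by (rule transD[OF *(2)])
  show "(a, b) \<in> r s \<Longrightarrow> (b, a) \<in> r s \<Longrightarrow> a = b" by (rule antisymD[OF *(3)])
  show "\<Sigma> s \<noteq> {}" by (rule *(4))
  show "a \<in> \<Sigma> s \<Longrightarrow> b \<in> \<Sigma> s \<Longrightarrow> \<exists>c\<in>\<Sigma> s. (a, c) \<in> r s \<and> (b, c) \<in> r s" using *(5) by blast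
qed

definition prod_index :: "('s \<Rightarrow> 'i option) set" where
  "prod_index = {g. dom g \<subseteq> S \<and> |dom g| \<le>o \<kappa> \<and> (\<forall>s a. g s = Some a \<longrightarrow> a \<in> \<Sigma> s)}"

text \<open>The last clause also forces \<open>dom g \<subseteq> dom h\<close>, so passing to a
  larger index may both add coordinates and move existing ones up.\<close>

definition prod_order :: "('s \<Rightarrow> 'i option) rel" where
  "prod_order = {(g, h). g \<in> prod_index \<and> h \<in> prod_index \<and>
     (\<forall>s a. g s = Some a \<longrightarrow> (\<exists>b. h s = Some b \<and> (a, b) \<in> r s))}"

definition prod_space :: "('s \<Rightarrow> 'i option) \<Rightarrow> ('s \<Rightarrow> 'p) topology" where
  "prod_space g = product_topology (\<lambda>s. X s (the (g s))) (dom g)"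

text \<open>Restricting to \<open>dom g\<close> gives \<open>undefined\<close> elsewhere, as for the
  points of \<open>prod_space g\<close>. Thus the identity and composition laws hold as equalities
  of functions.\<close>

definition prod_bond :: "('s \<Rightarrow> 'i option) \<Rightarrow> ('s \<Rightarrow> 'i option) \<Rightarrow> ('s \<Rightarrow> 'p) \<Rightarrow> 's \<Rightarrow> 'p" where
  "prod_bond h g x = (\<lambda>s\<in>dom g. p s (the (h s)) (the (g s)) (x s))"

definition coords :: "('s \<Rightarrow> 'i option) set \<Rightarrow> 's \<Rightarrow> 'i set" where
  "coords A s = {a. \<exists>g\<in>A. g s = Some a}"

lemma prod_indexD:
  assumes "g \<in> prod_index" "g s = Some a"
  shows "s \<in> S" "a \<in> \<Sigma> s"
  using assms by (auto simp: prod_index_def)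

lemma prod_orderD:
  assumes "(g, h) \<in> prod_order"
  shows "g \<in> prod_index" "h \<in> prod_index"
    and "g s = Some a \<Longrightarrow> \<exists>b. h s = Some b \<and> (a, b) \<in> r s"
  using assms by (auto simp: prod_order_def)

lemma partial_order_on_prod_order: "partial_order_on prod_index prod_order"
  unfolding partial_order_on_def preorder_on_def
proof (intro conjI)
  show "prod_order \<subseteq> prod_index \<times> prod_index" by (auto simp: prod_order_def)
  show "refl_on prod_index prod_order"
    unfolding refl_on_def prod_order_def by (auto dest: prod_indexD intro: index_refl)
  show "trans prod_order"
  proof (rule transI)
    fix g h k assume gh: "(g, h) \<in> prod_order" and hk: "(h, k) \<in> prod_order"
    have "\<exists>c. k s = Some c \<and> (a, c) \<in> r s" if a: "g s = Some a" for s a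
    proof -
      obtain b where b: "h s = Some b" "(a, b) \<in> r s"
        using prod_orderD(3)[OF gh a] by blast
      moreover obtain c where "k s = Some c" "(b, c) \<in> r s"
        using prod_orderD(3)[OF hk b(1)] by blast
      moreover have "s \<in> S"
        using gh a prod_indexD(1) prod_orderD(1) by blast
      ultimately show ?thesis using index_trans by blast
    qed
    then show "(g, k) \<in> prod_order"
      using gh hk by (auto simp: prod_order_def)
  qed
  show "antisym prod_order"
  proof (rule antisymI)
    fix g h assume gh: "(g, h) \<in> prod_order" and hg: "(h, g) \<in> prod_order"
    show "g = h"
    proof
      fix s
      show "g s = h s"
      proof (cases "g s")
        case None
        then show ?thesis using prod_orderD(3)[OF hg, of s] by (cases "h s") auto
      next
        case (Some a)
        then obtain b where b: "h s = Some b" "(a, b) \<in> r s"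
          using prod_orderD(3)[OF gh] by blast
        moreover have "(b, a) \<in> r s"
          using prod_orderD(3)[OF hg b(1)] Some by auto
        moreover have "s \<in> S"
          using Some prod_indexD(1) prod_orderD(1)[OF gh] by blast
        ultimately show ?thesis using Some index_antisym by simp
      qed
    qed
  qed
qed

lemma directed_prod_index:
  assumes g: "g \<in> prod_index" and h: "h \<in> prod_index"
  shows "\<exists>k\<in>prod_index. (g, k) \<in> prod_order \<and> (h, k) \<in> prod_order"
proof -
  obtain u where u: "\<And>s a b. s \<in> S \<Longrightarrow> a \<in> \<Sigma> s \<Longrightarrow> b \<in> \<Sigma> s \<Longrightarrow>
      u s a b \<in> \<Sigma> s \<and> (a, u s a b) \<in> r s \<and> (b, u s a b) \<in> r s"
    using directed by metis
  \<comment> \<open>Where both \<open>g\<close> and \<open>h\<close> are defined, \<open>k\<close>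
    takes the upper bound chosen by \<open>u\<close>; elsewhere it copies whichever value
    exists.\<close>
  define k where "k s = (case g s of None \<Rightarrow> h s
    | Some a \<Rightarrow> (case h s of None \<Rightarrow> Some a | Some b \<Rightarrow> Some (u s a b)))" for s
  have dom_k: "dom k = dom g \<union> dom h"
    by (auto simp: k_def dom_def split: option.splits)
  have "|dom k| \<le>o \<kappa>"
    unfolding dom_k using g h \<kappa> by (intro Un_Cinfinite_bound) (auto simp: prod_index_def)
  moreover have "dom k \<subseteq> S"
    unfolding dom_k using g h by (auto simp: prod_index_def)
  moreover have "a \<in> \<Sigma> s" if "k s = Some a" for s a
    using that prod_indexD[OF g, of s] prod_indexD[OF h, of s] u[of s]
    by (auto simp: k_def split: option.splits)
  ultimately have k: "k \<in> prod_index"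
    by (simp add: prod_index_def)
  have "\<exists>c. k s = Some c \<and> (a, c) \<in> r s" if "g s = Some a" for s a
    using that prod_indexD[OF g, of s] prod_indexD[OF h, of s] u[of s]
    by (cases "h s") (auto simp: k_def intro: index_refl)
  moreover have "\<exists>c. k s = Some c \<and> (b, c) \<in> r s" if "h s = Some b" for s b
    using that prod_indexD[OF g, of s] prod_indexD[OF h, of s] u[of s]
    by (cases "g s") (auto simp: k_def intro: index_refl)
  ultimately show ?thesis
    using g h k by (auto simp: prod_order_def)
qed

lemma directed_set_prod_index: "directed_set prod_index prod_order"
proof -
  \<comment> \<open>The empty partial function shows that the index set is nonempty, even when
    \<open>S\<close> is empty.\<close>
  have "Map.empty \<in> prod_index"
    using \<kappa> by (simp add: prod_index_def card_of_empty1)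
  then show ?thesis
    unfolding directed_set_def
    using partial_order_on_prod_order directed_prod_index by blast
qed

lemma skeletal_prod_bond:
  assumes gh: "(g, h) \<in> prod_order"
  shows "skeletal_map (prod_space h) (prod_space g) (prod_bond h g)"
proof -
  note g = prod_orderD(1)[OF gh] and h = prod_orderD(2)[OF gh]
  have "dom g \<subseteq> dom h"
    using prod_orderD(3)[OF gh] by blast
  moreover have "skeletal_map (X s (the (h s))) (X s (the (g s))) (p s (the (h s)) (the (g s)))"
    if "s \<in> dom g" for s
    using that prod_orderD(3)[OF gh, of s] prod_indexD(1)[OF g, of s] skeletal[of s] by force
  moreover have "topspace (X s (the (h s))) \<noteq> {}" if "s \<in> dom h" for s
    using that prod_indexD[OF h, of s] nonempty[of s] by force
  ultimately show ?thesis
    unfolding prod_space_def prod_bond_def by (rule skeletal_map_product_topology)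
qed

lemma t0_prod_space: "g \<in> prod_index \<Longrightarrow> t0_space (prod_space g)"
  unfolding prod_space_def t0_space_product_topology
  by (force dest: prod_indexD intro: t0)

lemma weight_prod_space: "g \<in> prod_index \<Longrightarrow> weight (prod_space g) \<le>o \<kappa>"
  unfolding prod_space_def using \<kappa>
  by (intro weight_product_topology) (auto simp: prod_index_def intro!: weight_le)

lemma inverse_system_prod: "inverse_system prod_index prod_order prod_space prod_bond"
  unfolding inverse_system_def
proof (intro conjI allI ballI impI)
  show "directed_set prod_index prod_order"
    by (rule directed_set_prod_index)
next
  fix g h assume "(g, h) \<in> prod_order"
  from skeletal_prod_bond[OF this]
  show "continuous_map (prod_space h) (prod_space g) (prod_bond h g)"
    "prod_bond h g ` topspace (prod_space h) = topspace (prod_space g)"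
    by (simp_all add: skeletal_map_def)
next
  fix g x assume g: "g \<in> prod_index" and x: "x \<in> topspace (prod_space g)"
  show "prod_bond g g x = x"
  proof
    fix s
    show "prod_bond g g x s = x s"
    proof (cases "g s")
      case None
      with x show ?thesis
        by (auto simp: prod_bond_def prod_space_def PiE_iff extensional_def)
    next
      case (Some a)
      with x have "x s \<in> topspace (X s a)"
        by (force simp: prod_space_def PiE_iff)
      with Some show ?thesis
        using prod_indexD[OF g Some] by (simp add: prod_bond_def domI bonding_id)
    qed
  qed
next
  fix g h k x assume "(g, h) \<in> prod_order \<and> (h, k) \<in> prod_order"
    and x: "x \<in> topspace (prod_space k)"
  then have gh: "(g, h) \<in> prod_order" and hk: "(h, k) \<in> prod_order" by auto
  show "prod_bond h g (prod_bond k h x) = prod_bond k g x"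
  proof
    fix s
    show "prod_bond h g (prod_bond k h x) s = prod_bond k g x s"
    proof (cases "g s")
      case None
      then show ?thesis by (simp add: prod_bond_def domIff)
    next
      case (Some a)
      then obtain b where b: "h s = Some b" "(a, b) \<in> r s"
        using prod_orderD(3)[OF gh] by blast
      then obtain c where c: "k s = Some c" "(b, c) \<in> r s"
        using prod_orderD(3)[OF hk] by blast
      have "x s \<in> topspace (X s c)"
        using x c by (force simp: prod_space_def PiE_iff)
      with Some b c show ?thesis
        using prod_indexD(1)[OF prod_orderD(1)[OF gh] Some]
        by (simp add: prod_bond_def domI bonding_comp)
    qed
  qed
qed

section \<open>Limits over directed sets of indices\<close>

text \<open>Here \<open>g\<close> and \<open>h\<close> need not be comparable. Both
  \<open>y g s\<close> and \<open>y h s\<close> are images of \<open>y k s\<close> for a common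
  upper bound \<open>k\<close> in \<open>B\<close>, and the bonding maps of factor \<open>s\<close>
  compose. For \<open>a = b\<close> this says that \<open>y g s\<close> depends only on
  \<open>s\<close> and \<open>g s\<close>.\<close>

lemma thread_coordinate:
  assumes "B \<subseteq> prod_index"
    and dir: "\<And>g h. g \<in> B \<Longrightarrow> h \<in> B \<Longrightarrow> \<exists>k\<in>B. (g, k) \<in> prod_order \<and> (h, k) \<in> prod_order"
    and y: "y \<in> topspace (inverse_limit B prod_order prod_space prod_bond)"
    and g: "g \<in> B" "g s = Some a" and h: "h \<in> B" "h s = Some b" and ab: "(a, b) \<in> r s"
  shows "p s b a (y h s) = y g s"
proof -
  obtain k where k: "k \<in> B" "(g, k) \<in> prod_order" "(h, k) \<in> prod_order"
    using dir g h by blast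
  then obtain c where c: "k s = Some c" "(b, c) \<in> r s"
    using prod_orderD(3)[OF k(3) h(2)] by blast
  have s: "s \<in> S"
    using g assms(1) prod_indexD(1) by blast
  have "y k \<in> topspace (prod_space k)"
    using y k(1) by (auto simp: topspace_inverse_limit PiE_iff)
  then have "y k s \<in> topspace (X s c)"
    using c by (force simp: prod_space_def PiE_iff)
  then have "p s b a (p s c b (y k s)) = p s c a (y k s)"
    using bonding_comp s ab c by blast
  moreover have "y g = prod_bond k g (y k)" "y h = prod_bond k h (y k)"
    using y k g h by (auto simp: topspace_inverse_limit)
  ultimately show ?thesis
    using g h c by (simp add: prod_bond_def domI)
qed

text \<open>Both sides carry the same data: the value at \<open>(g, s)\<close> on the right is the
  value at \<open>(s, the (g s))\<close> on the left. The inverse reads the value at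
  \<open>(s, a)\<close> from an arbitrary \<open>g\<close> in \<open>B\<close> with
  \<open>g s = Some a\<close>; by \<open>thread_coordinate\<close> the choice is immaterial.\<close>

lemma homeomorphic_maps_prod_limit:
  assumes B: "B \<subseteq> prod_index"
    and dir: "\<And>g h. g \<in> B \<Longrightarrow> h \<in> B \<Longrightarrow> \<exists>k\<in>B. (g, k) \<in> prod_order \<and> (h, k) \<in> prod_order"
  shows "homeomorphic_maps
    (product_topology (\<lambda>s. inverse_limit (coords B s) (r s) (X s) (p s)) (\<Union>(dom ` B)))
    (inverse_limit B prod_order prod_space prod_bond)
    (\<lambda>x. \<lambda>g\<in>B. \<lambda>s\<in>dom g. x s (the (g s)))
    (\<lambda>y. \<lambda>s\<in>\<Union>(dom ` B). \<lambda>a\<in>coords B s. y (SOME g. g \<in> B \<and> g s = Some a) s)"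
    (is "homeomorphic_maps (product_topology ?L ?D) ?M ?f ?h")
proof -
  let ?P = "product_topology ?L ?D"
  define e where "e a s = (SOME g. g \<in> B \<and> g s = Some a)" for a s
  have e: "e a s \<in> B" "e a s s = Some a" if "a \<in> coords B s" for a s
    using that someI_ex[of "\<lambda>g. g \<in> B \<and> g s = Some a"] by (auto simp: e_def coords_def)
  have D: "s \<in> S" if "s \<in> ?D" for s
    using that B prod_indexD(1) by blast
  have coords: "a \<in> \<Sigma> s" if "a \<in> coords B s" for a s
    using that B prod_indexD by (auto simp: coords_def)
  have mem: "s \<in> ?D" "the (g s) \<in> coords B s" "s \<in> S" if "g \<in> B" "s \<in> dom g" for g s
    using that B prod_indexD(1) by (auto simp: coords_def)
  have coord: "y g s \<in> topspace (X s a)" if "y \<in> topspace ?M" "g \<in> B" "g s = Some a" for y g s a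
  proof -
    have "y g \<in> topspace (prod_space g)"
      using that by (auto simp: topspace_inverse_limit PiE_iff)
    with that(3) show ?thesis
      by (force simp: prod_space_def PiE_iff)
  qed
  have f_coord: "continuous_map ?P (X s a) (\<lambda>x. x s a)" if "s \<in> ?D" "a \<in> coords B s" for s a
    using continuous_map_compose[OF continuous_map_product_projection[of s ?D ?L, OF that(1)]
        continuous_map_inverse_limit_projection[OF that(2)]]
    by (simp add: o_def)
  have f_cont: "continuous_map ?P (prod_space g) (\<lambda>x. ?f x g)" if "g \<in> B" for g
    unfolding prod_space_def continuous_map_componentwise
  proof (intro conjI ballI)
    fix s assume "s \<in> dom g"
    with that show "continuous_map ?P (X s (the (g s))) (\<lambda>x. ?f x g s)"
      using f_coord[OF mem(1,2)[OF that]] by simp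
  qed (use that in auto)
  have f_thread: "?f x \<in> topspace ?M" if x: "x \<in> topspace ?P" for x
    unfolding topspace_inverse_limit
  proof (intro conjI ballI impI)
    show "?f x \<in> (\<Pi>\<^sub>E g\<in>B. topspace (prod_space g))"
      unfolding PiE_iff
    proof (intro conjI ballI)
      fix g assume "g \<in> B"
      from continuous_map_image_subset_topspace[OF f_cont[OF this]] x
      show "?f x g \<in> topspace (prod_space g)" by blast
    qed simp
    fix g h assume g: "g \<in> B" and h: "h \<in> B" and gh: "(g, h) \<in> prod_order"
    have "p s (the (h s)) (the (g s)) (x s (the (h s))) = x s (the (g s))" "s \<in> dom h"
      \<comment> \<open>The thread condition for \<open>?f x\<close> between \<open>g\<close> and
        \<open>h\<close> is, coordinate by coordinate, the thread condition for \<open>x s\<close>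
        between \<open>g s\<close> and \<open>h s\<close>.\<close>
      if s: "s \<in> dom g" for s
    proof -
      from s obtain a where a: "g s = Some a" by blast
      then obtain b where b: "h s = Some b" "(a, b) \<in> r s"
        using prod_orderD(3)[OF gh] by blast
      have "x s \<in> topspace (?L s)"
        using x mem(1)[OF g s] by (auto simp: PiE_iff)
      then have "p s b a (x s b) = x s a"
        using a b g h unfolding topspace_inverse_limit coords_def by blast
      with a b show "p s (the (h s)) (the (g s)) (x s (the (h s))) = x s (the (g s))" "s \<in> dom h"
        by auto
    qed
    with g h show "prod_bond h g (?f x h) = ?f x g"
      unfolding prod_bond_def by auto
  qed
  have h_coord: "continuous_map ?M (X s a) (\<lambda>y. y (e a s) s)" if "a \<in> coords B s" for s a
  proof -
    have "continuous_map (prod_space (e a s)) (X s (the (e a s s))) (\<lambda>z. z s)"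
      unfolding prod_space_def using e[OF that]
      by (intro continuous_map_product_projection) auto
    then have "continuous_map (prod_space (e a s)) (X s a) (\<lambda>z. z s)"
      using e[OF that] by simp
    from continuous_map_compose[OF continuous_map_inverse_limit_projection
        [of _ _ prod_order prod_space prod_bond, OF e(1)[OF that]] this]
    show ?thesis by (simp add: o_def)
  qed
  \<comment> \<open>For \<open>(a, b) \<in> r s\<close> the representatives \<open>e a s\<close> and
    \<open>e b s\<close> may be incomparable, so the thread property of \<open>y\<close> alone does
    not suffice and \<open>thread_coordinate\<close> is applied.\<close>
  have h_thread: "(\<lambda>a\<in>coords B s. y (e a s) s) \<in> topspace (?L s)"
    if "s \<in> ?D" "y \<in> topspace ?M" for s y
    unfolding topspace_inverse_limit
    using that e coord thread_coordinate[OF B dir, of y] by auto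
  have h_cont: "continuous_map ?M ?P ?h"
    unfolding continuous_map_componentwise
  proof (intro conjI ballI)
    fix s assume s: "s \<in> ?D"
    have "continuous_map ?M (?L s) (\<lambda>y. \<lambda>a\<in>coords B s. y (e a s) s)"
      using h_thread[OF s] h_coord by (intro continuous_map_into_inverse_limit) auto
    with s show "continuous_map ?M (?L s) (\<lambda>y. ?h y s)"
      by (simp add: e_def)
  qed auto
  show ?thesis
    unfolding homeomorphic_maps_def
  proof (intro conjI ballI h_cont)
    show "continuous_map ?P ?M ?f"
      using f_thread f_cont by (rule continuous_map_into_inverse_limit)
  next
    fix x assume x: "x \<in> topspace ?P"
    show "?h (?f x) = x"
    proof
      fix s
      show "?h (?f x) s = x s"
      proof (cases "s \<in> ?D")
        case False
        with x show ?thesis by (auto simp: PiE_iff extensional_def)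
      next
        case True
        with x have "x s \<in> extensional (coords B s)"
          by (auto simp: PiE_iff topspace_inverse_limit)
        moreover have "?f x (e a s) s = x s a" if "a \<in> coords B s" for a
          using e[OF that] by (simp add: domI)
        ultimately show ?thesis
          using True by (auto simp: e_def extensional_def fun_eq_iff)
      qed
    qed
  next
    fix y assume y: "y \<in> topspace ?M"
    have "?f (?h y) g = y g" if g: "g \<in> B" for g
    proof
      fix s
      have yg: "y g \<in> extensional (dom g)"
        using y g by (auto simp: topspace_inverse_limit PiE_iff prod_space_def)
      show "?f (?h y) g s = y g s"
      proof (cases "g s")
        case None
        with yg g show ?thesis by (auto simp: extensional_def)
      next
        case (Some a)
        then have a: "a \<in> coords B s" and s: "s \<in> ?D"
          using g by (auto simp: coords_def)
        \<comment> \<open>Reflexivity lets \<open>thread_coordinate\<close> compare \<open>g\<close>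
          with the representative \<open>e a s\<close> of the same value \<open>a\<close>; the
          bonding map between them is the identity.\<close>
        have "(a, a) \<in> r s"
          using index_refl D[OF s] coords[OF a] by blast
        then have "p s a a (y (e a s) s) = y g s"
          using thread_coordinate[OF B dir y g Some e[OF a]] by blast
        moreover have "p s a a (y (e a s) s) = y (e a s) s"
          using bonding_id[OF D[OF s] coords[OF a]] coord[OF y e[OF a]] by blast
        ultimately show ?thesis
          using Some g a s by (simp add: domI e_def)
      qed
    qed
    moreover have "y \<in> extensional B"
      using y by (auto simp: topspace_inverse_limit PiE_iff)
    ultimately show "?f (?h y) = y"
      by (auto simp: extensional_def fun_eq_iff)
  qed
qed

section \<open>Suprema of chains and \<kappa>-completeness\<close>

text \<open>Comparability of two members of \<open>A\<close> passes to their values at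
  \<open>s\<close>, and the values form the image of a part of \<open>A\<close>. Some member is
  defined at \<open>s\<close>, so the chain of values is nonempty.\<close>

lemma chain_coords:
  assumes A: "short_chain \<kappa> prod_index prod_order A" and s: "s \<in> \<Union>(dom ` A)"
  shows "s \<in> S" "short_chain \<kappa> (\<Sigma> s) (r s) (coords A s)"
proof -
  have sub: "A \<subseteq> prod_index" and chain: "\<And>g h. g \<in> A \<Longrightarrow> h \<in> A \<Longrightarrow> (g, h) \<in> prod_order \<or> (h, g) \<in> prod_order"
    and card: "|A| \<le>o \<kappa>"
    using A by (auto simp: short_chain_def Chains_def)
  show "s \<in> S"
    using s sub prod_indexD(1) by blast
  have "coords A s \<subseteq> \<Sigma> s" "coords A s \<noteq> {}"
    using s sub by (auto simp: prod_index_def coords_def)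
  moreover have "coords A s \<in> Chains (r s)"
    unfolding Chains_def
  proof (intro CollectI ballI)
    fix a b assume "a \<in> coords A s" "b \<in> coords A s"
    then obtain g h where "g \<in> A" "h \<in> A" "g s = Some a" "h s = Some b"
      by (auto simp: coords_def)
    with chain[of g h] show "(a, b) \<in> r s \<or> (b, a) \<in> r s"
      by (auto dest: prod_orderD(3))
  qed
  moreover have "|coords A s| \<le>o \<kappa>"
  proof -
    have "coords A s \<subseteq> (\<lambda>g. the (g s)) ` A"
      by (force simp: coords_def)
    with card show ?thesis
      by (meson card_of_image card_of_mono1 ordLeq_transitive)
  qed
  ultimately show "short_chain \<kappa> (\<Sigma> s) (r s) (coords A s)"
    by (simp add: short_chain_def)
qed

text \<open>Besides existence, the domain and the values of the supremum are recorded: they allow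
  the limit over \<open>A\<close> to be computed factor by factor.\<close>

lemma chain_lub:
  assumes A: "short_chain \<kappa> prod_index prod_order A"
  obtains \<sigma> where "least_upper_bound prod_index prod_order A \<sigma>" "dom \<sigma> = \<Union>(dom ` A)"
    "\<And>s. s \<in> \<Union>(dom ` A) \<Longrightarrow> least_upper_bound (\<Sigma> s) (r s) (coords A s) (the (\<sigma> s))"
proof -
  let ?D = "\<Union>(dom ` A)"
  have sub: "A \<subseteq> prod_index" and card: "|A| \<le>o \<kappa>"
    using A by (auto simp: short_chain_def)
  have "\<forall>s\<in>?D. \<exists>a. least_upper_bound (\<Sigma> s) (r s) (coords A s) a"
    using chain_has_lub chain_coords[OF A] by blast
  from bchoice[OF this] obtain l
    where l: "\<And>s. s \<in> ?D \<Longrightarrow> least_upper_bound (\<Sigma> s) (r s) (coords A s) (l s)"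
    by blast
  define \<sigma> where "\<sigma> s = (if s \<in> ?D then Some (l s) else None)" for s
  have dom: "dom \<sigma> = ?D"
    by (auto simp: \<sigma>_def dom_def)
  \<comment> \<open>A union of at most \<kappa> domains of size at most \<kappa> is again admissible
    as a domain.\<close>
  have "|?D| \<le>o \<kappa>"
    using card sub \<kappa> by (intro UNION_Cinfinite_bound) (auto simp: prod_index_def)
  then have \<sigma>: "\<sigma> \<in> prod_index"
    using chain_coords(1)[OF A] l unfolding prod_index_def
    by (auto simp: dom) (auto simp: \<sigma>_def least_upper_bound_def split: if_splits)
  have "least_upper_bound prod_index prod_order A \<sigma>"
    unfolding least_upper_bound_def
  proof (intro conjI ballI impI \<sigma>)
    fix g assume g: "g \<in> A"
    have "\<exists>b. \<sigma> s = Some b \<and> (a, b) \<in> r s" if "g s = Some a" for s a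
    proof -
      have "s \<in> ?D" "a \<in> coords A s"
        using that g by (auto simp: coords_def)
      with l show ?thesis
        by (auto simp: \<sigma>_def least_upper_bound_def)
    qed
    with g sub \<sigma> show "(g, \<sigma>) \<in> prod_order"
      by (auto simp: prod_order_def)
  next
    fix \<tau> assume \<tau>: "\<tau> \<in> prod_index" and ub: "\<forall>g\<in>A. (g, \<tau>) \<in> prod_order"
    have "\<exists>b. \<tau> s = Some b \<and> (a, b) \<in> r s" if "\<sigma> s = Some a" for s a
    proof -
      have s: "s \<in> ?D" and a: "a = l s"
        using that by (auto simp: \<sigma>_def split: if_splits)
      \<comment> \<open>An upper bound \<open>\<tau>\<close> is defined at \<open>s\<close> because
        it lies above some \<open>g\<close> in \<open>A\<close> that is defined there.\<close>
      then obtain g c where "g \<in> A" "g s = Some c" by blast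
      then obtain b where b: "\<tau> s = Some b"
        using ub prod_orderD(3) by blast
      have "(c, b) \<in> r s" if "c \<in> coords A s" for c
        using that ub b by (auto simp: coords_def dest!: bspec prod_orderD(3))
      moreover have "b \<in> \<Sigma> s"
        using \<tau> b prod_indexD(2) by blast
      ultimately show ?thesis
        using l[OF s] a b by (auto simp: least_upper_bound_def)
    qed
    with \<tau> \<sigma> show "(\<sigma>, \<tau>) \<in> prod_order"
      by (auto simp: prod_order_def)
  qed
  moreover have "least_upper_bound (\<Sigma> s) (r s) (coords A s) (the (\<sigma> s))" if "s \<in> ?D" for s
    using l[OF that] that by (simp add: \<sigma>_def)
  ultimately show thesis
    using dom that by blast
qed

text \<open>The canonical map onto the limit over a chain is a composite: the product of the
  canonical homeomorphisms of the factors (fact \<open>1\<close>), followed by the regrouping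
  homeomorphism (fact \<open>2\<close>).\<close>

lemma complete_inverse_system_prod:
  "complete_inverse_system \<kappa> prod_index prod_order prod_space prod_bond"
  unfolding complete_inverse_system_def complete_directed_set_def
proof (intro conjI allI impI inverse_system_prod directed_set_prod_index)
  fix A assume "short_chain \<kappa> prod_index prod_order A"
  then show "\<exists>\<sigma>. least_upper_bound prod_index prod_order A \<sigma>"
    by (rule chain_lub) (rule exI)
next
  fix A \<sigma> assume "short_chain \<kappa> prod_index prod_order A \<and> least_upper_bound prod_index prod_order A \<sigma>"
  then have A: "short_chain \<kappa> prod_index prod_order A"
    and \<sigma>: "least_upper_bound prod_index prod_order A \<sigma>" by auto
  let ?D = "\<Union>(dom ` A)"
  let ?L = "\<lambda>s. inverse_limit (coords A s) (r s) (X s) (p s)"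
  let ?\<phi> = "\<lambda>s x. \<lambda>a\<in>coords A s. p s (the (\<sigma> s)) a x"
  obtain \<sigma>' where \<sigma>': "least_upper_bound prod_index prod_order A \<sigma>'" "dom \<sigma>' = ?D"
      "\<And>s. s \<in> ?D \<Longrightarrow> least_upper_bound (\<Sigma> s) (r s) (coords A s) (the (\<sigma>' s))"
    using chain_lub[OF A] by blast
  \<comment> \<open>Antisymmetry identifies the given supremum \<open>\<sigma>\<close> with the
    coordinatewise one, whose domain and values are known.\<close>
  have "antisym prod_order"
    using partial_order_on_prod_order by (simp add: partial_order_on_def)
  then have "\<sigma>' = \<sigma>"
    using \<sigma> \<sigma>'(1) unfolding least_upper_bound_def by (meson antisymD)
  note \<sigma>' = \<sigma>'[unfolded this]
  have "homeomorphic_map (X s (the (\<sigma> s))) (?L s) (?\<phi> s)" if "s \<in> ?D" for s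
    using chain_limit chain_coords[OF A that] \<sigma>'(3)[OF that] by blast
  then obtain \<psi> where "\<And>s. s \<in> ?D \<Longrightarrow> homeomorphic_maps (X s (the (\<sigma> s))) (?L s) (?\<phi> s) (\<psi> s)"
    unfolding homeomorphic_map_maps by metis
  from homeomorphic_maps_imp_map[OF homeomorphic_maps_product_topology[OF this]]
  have 1: "homeomorphic_map (prod_space \<sigma>) (product_topology ?L ?D) (\<lambda>x. \<lambda>s\<in>?D. ?\<phi> s (x s))"
    unfolding prod_space_def \<sigma>'(2) .
  have sub: "A \<subseteq> prod_index" and chain: "\<And>g h. g \<in> A \<Longrightarrow> h \<in> A \<Longrightarrow> (g, h) \<in> prod_order \<or> (h, g) \<in> prod_order"
    using A by (auto simp: short_chain_def Chains_def)
  have "(g, g) \<in> prod_order" if "g \<in> A" for g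
    using that sub partial_order_on_prod_order
    by (auto simp: partial_order_on_def preorder_on_def refl_on_def)
  \<comment> \<open>A chain is directed: the larger of \<open>g\<close> and \<open>h\<close> serves
    as \<open>k\<close>.\<close>
  then have "\<exists>k\<in>A. (g, k) \<in> prod_order \<and> (h, k) \<in> prod_order" if "g \<in> A" "h \<in> A" for g h
    using chain[OF that] that by blast
  from homeomorphic_maps_imp_map[OF homeomorphic_maps_prod_limit[OF sub this]]
  have 2: "homeomorphic_map (product_topology ?L ?D) (inverse_limit A prod_order prod_space prod_bond)
      (\<lambda>x. \<lambda>g\<in>A. \<lambda>s\<in>dom g. x s (the (g s)))" .
  show "homeomorphic_map (prod_space \<sigma>) (inverse_limit A prod_order prod_space prod_bond)
      (\<lambda>x. \<lambda>g\<in>A. prod_bond \<sigma> g x)"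
  proof (rule homeomorphic_map_eq[OF homeomorphic_map_compose[OF 1 2]])
    fix x assume "x \<in> topspace (prod_space \<sigma>)"
    show "((\<lambda>x. \<lambda>g\<in>A. \<lambda>s\<in>dom g. x s (the (g s))) \<circ> (\<lambda>x. \<lambda>s\<in>?D. ?\<phi> s (x s))) x =
        (\<lambda>g\<in>A. prod_bond \<sigma> g x)"
    proof (intro ext)
      fix g s
      \<comment> \<open>These memberships make the inner restrictions of the composite transparent,
        leaving exactly the value of \<open>prod_bond\<close>.\<close>
      have "s \<in> ?D" "the (g s) \<in> coords A s" if "g \<in> A" "s \<in> dom g"
        using that by (auto simp: coords_def)
      then show "((\<lambda>x. \<lambda>g\<in>A. \<lambda>s\<in>dom g. x s (the (g s))) \<circ> (\<lambda>x. \<lambda>s\<in>?D. ?\<phi> s (x s))) x g s =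
          (\<lambda>g\<in>A. prod_bond \<sigma> g x) g s"
        by (auto simp: prod_bond_def restrict_def)
    qed
  qed
qed

section \<open>The limit of the whole system\<close>

text \<open>The regrouping homeomorphism is applied to all of \<open>prod_index\<close>. The
  one-point functions \<open>[s \<mapsto> a]\<close> are indices, so every \<open>s\<close> in
  \<open>S\<close> and every \<open>a\<close> in \<open>\<Sigma> s\<close> occurs.\<close>

lemma product_homeomorphic_prod_limit:
  "product_topology (\<lambda>s. inverse_limit (\<Sigma> s) (r s) (X s) (p s)) S homeomorphic_space
    inverse_limit prod_index prod_order prod_space prod_bond"
proof -
  have single: "[s \<mapsto> a] \<in> prod_index" if "s \<in> S" "a \<in> \<Sigma> s" for s a
  proof -
    have "Field \<kappa> \<noteq> {}"
      using \<kappa> by (auto simp: cinfinite_def)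
    with that \<kappa> show ?thesis
      by (auto simp: prod_index_def Card_order_singl_ordLeq split: if_splits)
  qed
  have D: "\<Union>(dom ` prod_index) = S"
  proof
    show "S \<subseteq> \<Union>(dom ` prod_index)"
    proof
      fix s assume s: "s \<in> S"
      then obtain a where "a \<in> \<Sigma> s"
        using index_nonempty by blast
      with single[OF s] show "s \<in> \<Union>(dom ` prod_index)"
        by (intro UN_I[of "[s \<mapsto> a]"]) auto
    qed
  qed (auto dest: prod_indexD(1))
  have "coords prod_index s = \<Sigma> s" if "s \<in> S" for s
  proof
    show "\<Sigma> s \<subseteq> coords prod_index s"
    proof
      fix a assume "a \<in> \<Sigma> s"
      then show "a \<in> coords prod_index s"
        unfolding coords_def using single[OF that] by (intro CollectI bexI[of _ "[s \<mapsto> a]"]) auto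
    qed
  qed (auto simp: coords_def dest: prod_indexD(2))
  then have "product_topology (\<lambda>s. inverse_limit (\<Sigma> s) (r s) (X s) (p s)) S homeomorphic_space
      product_topology (\<lambda>s. inverse_limit (coords prod_index s) (r s) (X s) (p s)) S"
    by (intro homeomorphic_space_product_topology) simp
  also have "\<dots> homeomorphic_space inverse_limit prod_index prod_order prod_space prod_bond"
    using homeomorphic_maps_prod_limit[OF subset_refl directed_prod_index]
    unfolding homeomorphic_space_def D by (intro exI)
  finally show ?thesis .
qed

lemma homeomorphic_product_in_skeletal_limits:
  assumes "\<And>s. s \<in> S \<Longrightarrow> Y s homeomorphic_space inverse_limit (\<Sigma> s) (r s) (X s) (p s)"
  shows "product_topology Y S \<in> skeletal_limits \<kappa> TYPE('s \<Rightarrow> 'i option) TYPE('s \<Rightarrow> 'p)"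
proof -
  have "product_topology Y S homeomorphic_space
      product_topology (\<lambda>s. inverse_limit (\<Sigma> s) (r s) (X s) (p s)) S"
    using assms by (rule homeomorphic_space_product_topology)
  also note product_homeomorphic_prod_limit
  finally show ?thesis
    unfolding skeletal_limits_def
    using complete_inverse_system_prod t0_prod_space weight_prod_space skeletal_prod_bond by blast
qed

end

section \<open>Empty spaces and the conclusion\<close>

text \<open>The empty space is the limit of the system consisting of itself over a single
  index.\<close>

lemma trivial_topology_in_skeletal_limits:
  assumes "Cinfinite \<kappa>"
  shows "trivial_topology \<in> skeletal_limits \<kappa> TYPE('i) TYPE('p)"
proof -
  fix i :: 'i
  let ?X = "\<lambda>_ :: 'i. trivial_topology :: 'p topology" and ?p = "\<lambda>_ _ :: 'i. id :: 'p \<Rightarrow> 'p"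
  let ?r = "{(i, i)}"
  have po: "partial_order_on {i} ?r"
    by (auto simp: partial_order_on_def preorder_on_def refl_on_def trans_def antisym_def)
  \<comment> \<open>A thread over a nonempty \<open>A\<close> would need a point of the empty space.
    Over \<open>A = {}\<close> the limit would be a singleton instead, so it matters that chains are
    nonempty.\<close>
  have trivial: "inverse_limit A ?r ?X ?p = trivial_topology" if ne: "A \<noteq> {}" for A
  proof -
    obtain a where "a \<in> A" using ne by blast
    then show ?thesis
      by (auto simp: topspace_inverse_limit PiE_iff simp flip: null_topspace_iff_trivial)
  qed
  have "skeletal_map (trivial_topology :: 'p topology) (trivial_topology :: 'p topology) id"
    by (auto simp: skeletal_map_def)
  moreover have "complete_inverse_system \<kappa> {i} ?r ?X ?p"
    unfolding complete_inverse_system_def complete_directed_set_def inverse_system_def directed_set_def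
  proof (intro conjI allI impI)
    fix A assume "short_chain \<kappa> {i} ?r A"
    then have "A = {i}" by (auto simp: short_chain_def)
    then show "\<exists>\<sigma>. least_upper_bound {i} ?r A \<sigma>"
      by (auto simp: least_upper_bound_def)
  next
    fix A \<sigma> assume "short_chain \<kappa> {i} ?r A \<and> least_upper_bound {i} ?r A \<sigma>"
    then have "A \<noteq> {}" by (auto simp: short_chain_def)
    then show "homeomorphic_map (?X \<sigma>) (inverse_limit A ?r ?X ?p) (\<lambda>x. \<lambda>\<alpha>\<in>A. ?p \<sigma> \<alpha> x)"
      by (simp add: trivial homeomorphic_map_def quotient_map_def)
  qed (use po in auto)
  moreover have "weight (trivial_topology :: 'p topology) \<le>o \<kappa>"
    \<comment> \<open>With no points to cover, the empty family is a base.\<close>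
    unfolding weight_le_iff base_of_def using assms
    by (intro exI[of _ "{}"]) (auto simp: card_of_empty1)
  ultimately show ?thesis
    unfolding skeletal_limits_def using trivial[of "{i}"]
    by (intro CollectI exI[of _ "{i}"] exI[of _ ?r] exI[of _ ?X] exI[of _ ?p]) (auto simp: t0_space_def homeomorphic_empty_space_eq)
qed

text \<open>The result types are those of the product system: partial functions on \<open>S\<close>
  serve as indices, and families of points of the factor systems as points.\<close>

theorem theorem7:
  fixes \<kappa> :: "'k rel" and S :: "'s set" and X :: "'s \<Rightarrow> 'x topology"
  assumes "Cinfinite \<kappa>"
    and "\<And>s. s \<in> S \<Longrightarrow> X s \<in> skeletal_limits \<kappa> TYPE('i) TYPE('p)"
  shows "product_topology X S \<in> skeletal_limits \<kappa> TYPE('s \<Rightarrow> 'i option) TYPE('s \<Rightarrow> 'p)"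
proof -
  \<comment> \<open>Bundling all conditions into one predicate lets the index set, order, spaces and
    bonding maps of every factor be chosen simultaneously.\<close>
  define P where "P s \<Sigma> r Z p \<longleftrightarrow> complete_inverse_system \<kappa> \<Sigma> r Z p \<and>
      (\<forall>\<sigma>\<in>\<Sigma>. t0_space (Z \<sigma>) \<and> weight (Z \<sigma>) \<le>o \<kappa>) \<and>
      (\<forall>\<rho> \<sigma>. (\<rho>, \<sigma>) \<in> r \<longrightarrow> skeletal_map (Z \<sigma>) (Z \<rho>) (p \<sigma> \<rho>)) \<and>
      X s homeomorphic_space inverse_limit \<Sigma> r Z p"
    for s and \<Sigma> :: "'i set" and r and Z :: "'i \<Rightarrow> 'p topology" and p
  have "\<exists>\<Sigma> r Z p. P s \<Sigma> r Z p" if "s \<in> S" for s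
    using assms(2)[OF that] unfolding P_def skeletal_limits_def by blast
  then obtain \<Sigma> r Z p where P: "\<And>s. s \<in> S \<Longrightarrow> P s (\<Sigma> s) (r s) (Z s) (p s)"
    by metis
  have system: "complete_inverse_system \<kappa> (\<Sigma> s) (r s) (Z s) (p s)"
    and t0: "\<And>a. a \<in> \<Sigma> s \<Longrightarrow> t0_space (Z s a)"
    and weight: "\<And>a. a \<in> \<Sigma> s \<Longrightarrow> weight (Z s a) \<le>o \<kappa>"
    and skeletal: "\<And>a b. (a, b) \<in> r s \<Longrightarrow> skeletal_map (Z s b) (Z s a) (p s b a)"
    and limit: "X s homeomorphic_space inverse_limit (\<Sigma> s) (r s) (Z s) (p s)" if "s \<in> S" for s
    using P[OF that] unfolding P_def by blast+
  show ?thesis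
  proof (cases "\<exists>s\<in>S. \<exists>a\<in>\<Sigma> s. topspace (Z s a) = {}")
    case True
    \<comment> \<open>An empty factor would make the projections that forget it fail to be surjective.\<close>
    then obtain s a where s: "s \<in> S" "a \<in> \<Sigma> s" "topspace (Z s a) = {}" by blast
    have "topspace (inverse_limit (\<Sigma> s) (r s) (Z s) (p s)) = {}"
      using s(2,3) by (auto simp: topspace_inverse_limit PiE_iff simp del: null_topspace_iff_trivial)
    then have "topspace (X s) = {}"
      using homeomorphic_empty_space[OF limit[OF s(1)]] by simp
    then have "product_topology X S = trivial_topology"
      using s(1) by (auto simp: product_topology_trivial_iff)
    then show ?thesis
      by (simp add: trivial_topology_in_skeletal_limits assms(1))
  next
    case False
    with assms(1) system t0 weight skeletal
    interpret skeletal_systems \<kappa> S \<Sigma> r Z p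
      by unfold_locales auto
    show ?thesis
      using limit by (rule homeomorphic_product_in_skeletal_limits)
  qed
qed

end
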